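(* If $L=\mathsf{conv}(L_1\cup L_2)$ where $L_1,L_2\subset\mathbb{R}^n$ are non-singleton (nonempty) compact convex sets, then $$\rho_\Delta(L)\le\rho_\Delta(L_1)+\rho_\Delta(L_2)+1,$$ where $\Delta=\Delta^n$ is the standard regular $n$-simplex.
   Context: $\Delta=\Delta^n\subset\mathbb{R}^n$ is the regular simplex obtained by orthogonally projecting $\mathsf{conv}\{e_1,\dots,e_{n+1}\}\subset\mathbb{R}^{n+1}$ to the hyperplane orthogonal to $(1,\dots,1)$ (identified isometrically with $\mathbb{R}^n$). For compact convex $K,L\subset\mathbb{R}^n$, $\lambda_K(L):=\inf\{\lambda\ge 0:\exists x\in\mathbb{R}^n,\ L\subset x+\lambda K\}$. For a compact convex $L$ that is not a point, $\rho_\Delta(L):=\lambda_{-\Delta}(L)/\lambda_\Delta(L)$. $\mathsf{conv}$ denotes convex hull. *)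

theory Defs
  imports "HOL-Analysis.Analysis"
begin

text \<open>
  For $n$ = \<open>CARD('n)\<close>, the space $R^{n+1}$ is \<open>real ^ 'n option\<close>, whose index type has
  $n + 1$ elements. In \<open>diag_hyperplane\<close> and \<open>diag_proj\<close>, \<open>1\<close> is the vector $(1,\dots,1)$.
\<close>

definition diag_hyperplane :: "(real ^ 'm) set" where
  "diag_hyperplane = {x. 1 \<bullet> x = 0}"

definition diag_proj :: "real ^ 'm \<Rightarrow> real ^ 'm" where
  "diag_proj x = x - ((1 \<bullet> x) / (1 \<bullet> (1 :: real ^ 'm))) *\<^sub>R 1"

lemma diag_proj_in_hyperplane: "diag_proj x \<in> diag_hyperplane"
proof -
  have "(1 :: real ^ 'a) \<noteq> 0" by simp
  then show ?thesis
    by (simp add: diag_proj_def diag_hyperplane_def inner_diff_right)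
qed

lemma diag_proj_orthogonal:
  assumes "y \<in> diag_hyperplane"
  shows "orthogonal (x - diag_proj x) y"
  using assms by (simp add: diag_proj_def diag_hyperplane_def orthogonal_def)

definition isometric_identification :: "(real ^ 'n \<Rightarrow> real ^ 'n option) \<Rightarrow> bool" where
  "isometric_identification \<iota> \<longleftrightarrow>
     linear \<iota> \<and> (\<forall>x. norm (\<iota> x) = norm x) \<and> range \<iota> = diag_hyperplane"

lemma isometric_identification_exists:
  "\<exists>\<iota> :: real ^ 'n \<Rightarrow> real ^ 'n option. isometric_identification \<iota>"
proof -
  have "dim (diag_hyperplane :: (real ^ 'n option) set) = CARD('n)"
    using dim_hyperplane[of "1 :: real ^ 'n option"]
    by (simp add: diag_hyperplane_def card_UNIV_option)
  then have "dim (UNIV :: (real ^ 'n) set) = dim (diag_hyperplane :: (real ^ 'n option) set)"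
    by simp
  moreover have "subspace (diag_hyperplane :: (real ^ 'n option) set)"
    by (simp add: diag_hyperplane_def subspace_hyperplane)
  ultimately obtain \<iota> :: "real ^ 'n \<Rightarrow> real ^ 'n option" and g
    where "linear \<iota>" "\<iota> ` UNIV = diag_hyperplane" "\<And>x. x \<in> UNIV \<Longrightarrow> norm (\<iota> x) = norm x"
    using isometries_subspaces[OF subspace_UNIV, where 'a = "real ^ 'n"] by metis
  then show ?thesis
    by (auto simp: isometric_identification_def)
qed

definition std_simplex :: "(real ^ 'n \<Rightarrow> real ^ 'n option) \<Rightarrow> (real ^ 'n) set" where
  "std_simplex \<iota> = \<iota> -` (diag_proj ` (convex hull (range (\<lambda>i. axis i 1))))"

text \<open>
  The infimum is taken in the reals, so \<open>circumscale K L\<close> is meaningful only if some scaled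
  translate of \<open>K\<close> contains \<open>L\<close>. This holds for bounded \<open>L\<close> when \<open>K\<close> is a simplex with
  nonempty interior, or its reflection.
\<close>

definition circumscale :: "(real ^ 'n) set \<Rightarrow> (real ^ 'n) set \<Rightarrow> real" where
  "circumscale K L = Inf {l. 0 \<le> l \<and> (\<exists>x. L \<subseteq> (\<lambda>y. x + l *\<^sub>R y) ` K)}"

definition rho :: "(real ^ 'n) set \<Rightarrow> (real ^ 'n) set \<Rightarrow> real" where
  "rho D L = circumscale (uminus ` D) L / circumscale D L"

end

theory Submission
  imports Defs
begin

text \<open>
  Identify $R^n$ with the hyperplane of zero-sum vectors in $R^{n+1}$ and write $m_i(L)$ and
  $M_i(L)$ for the infimum and supremum of the $i$-th coordinate over \<open>L\<close>. In these coordinates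
  the simplex is cut out by the inequalities $y_i \ge -1/(n+1)$, so a translate of
  $\lambda\Delta$ is an arbitrary system of lower bounds on the coordinates with total
  $-\lambda$. Hence the smallest $\lambda$ for \<open>L\<close> is $-\sum_i m_i(L)$
  (\<open>circumscale_std_simplex\<close>), and by reflection the smallest one for $-\Delta$ is
  $\sum_i M_i(L)$ (\<open>circumscale_neg_std_simplex\<close>).

  Now put $p = -\sum_i m_i(L_1)$, $P = \sum_i M_i(L_1)$, define $q$, $Q$ likewise from $L_2$, and
  $l = -\sum_i m_i(L)$. The identity $\max + \min = $ sum gives
  \[ \sum_i M_i(L) \le \sum_i \max(M_i(L_1), M_i(L_2))
     = P + Q - \sum_i \min(M_i(L_1), M_i(L_2)) \le P + Q + l, \]
  the last step because $M_i(L_j) \ge m_i(L_j) \ge m_i(L)$. Dividing by \<open>l\<close>, which is at least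
  $p$ and $q$, yields $P/l + Q/l + 1 \le P/p + Q/q + 1$. The denominators are positive because a set
  that is not a point has $\sum_i m_i < 0$ (\<open>sum_coord_INF_neg\<close>).
\<close>

section \<open>Zero-sum coordinates\<close>

lemma inner_one_vec: "1 \<bullet> (x :: real ^ 'm) = (\<Sum>i\<in>UNIV. x $ i)"
  by (simp add: inner_vec_def)

lemma iso_linear: "isometric_identification \<iota> \<Longrightarrow> linear \<iota>"
  by (simp add: isometric_identification_def)

lemma iso_sum_zero:
  assumes "isometric_identification \<iota>"
  shows "(\<Sum>i\<in>UNIV. \<iota> x $ i) = 0"
proof -
  have "\<iota> x \<in> diag_hyperplane"
    using assms by (auto simp: isometric_identification_def)
  then show ?thesis
    by (simp add: diag_hyperplane_def inner_one_vec)
qed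

lemma iso_onto_zero_sum:
  assumes "isometric_identification \<iota>" and "(\<Sum>i\<in>UNIV. y $ i) = 0"
  obtains x where "\<iota> x = y"
proof -
  have "y \<in> diag_hyperplane"
    using assms(2) by (simp add: diag_hyperplane_def inner_one_vec)
  then have "y \<in> range \<iota>"
    using assms(1) by (simp add: isometric_identification_def)
  then show ?thesis
    using that by auto
qed

lemma iso_inj:
  assumes "isometric_identification \<iota>" and "\<iota> x = \<iota> y"
  shows "x = y"
proof -
  have "norm (x - y) = norm (\<iota> (x - y))"
    using assms(1) by (simp add: isometric_identification_def)
  also have "\<dots> = 0"
    using assms by (simp add: linear_diff[OF iso_linear])
  finally show ?thesis by simp
qed

lemma bounded_coord_image:
  assumes "isometric_identification \<iota>" and "bounded L"
  shows "bounded ((\<lambda>x. \<iota> x $ i) ` L)"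
proof -
  obtain B where B: "\<And>x. x \<in> L \<Longrightarrow> norm x \<le> B"
    using assms(2) by (auto simp: bounded_iff)
  have "norm (\<iota> x $ i) \<le> B" if "x \<in> L" for x
  proof -
    have "norm (\<iota> x $ i) \<le> norm (\<iota> x)"
      by (simp add: component_le_norm_cart)
    also have "\<dots> = norm x"
      using assms(1) by (simp add: isometric_identification_def)
    finally show ?thesis using B[OF that] by simp
  qed
  then show ?thesis by (auto simp: bounded_iff)
qed

lemma bdd_coord:
  assumes "isometric_identification \<iota>" and "bounded L"
  shows "bdd_below ((\<lambda>x. \<iota> x $ i) ` L)" and "bdd_above ((\<lambda>x. \<iota> x $ i) ` L)"
  using bounded_coord_image[OF assms] by (auto intro: bounded_imp_bdd_below bounded_imp_bdd_above)

section \<open>Scaled translates of the simplex as systems of lower bounds\<close>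

lemma convex_hull_axes:
  "convex hull (range (\<lambda>i. axis i 1)) = {z :: real ^ 'm. (\<forall>i. 0 \<le> z $ i) \<and> (\<Sum>i\<in>UNIV. z $ i) = 1}"
  (is "?H = ?S")
proof
  have "convex ?S"
    by (auto simp: convex_def sum.distrib simp flip: sum_distrib_left)
  moreover have "range (\<lambda>i. axis i 1) \<subseteq> ?S"
    by (auto simp: axis_def)
  ultimately show "?H \<subseteq> ?S"
    by (rule hull_minimal[rotated])
  show "?S \<subseteq> ?H"
  proof
    fix z :: "real ^ 'm" assume z: "z \<in> ?S"
    have "(\<Sum>i\<in>UNIV. z $ i *\<^sub>R axis i 1) \<in> ?H"
      using z by (intro convex_sum) (auto intro: hull_inc)
    moreover have "(\<Sum>i\<in>UNIV. z $ i *\<^sub>R axis i 1) = z"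
      using basis_expansion[of z] by (simp add: scalar_mult_eq_scaleR)
    ultimately show "z \<in> ?H" by simp
  qed
qed

lemma mem_std_simplex:
  fixes \<iota> :: "real ^ 'n \<Rightarrow> real ^ 'n option"
  assumes "isometric_identification \<iota>"
  shows "y \<in> std_simplex \<iota> \<longleftrightarrow> (\<forall>i. - 1 / real CARD('n option) \<le> \<iota> y $ i)"
    (is "_ \<longleftrightarrow> (\<forall>i. - 1 / ?N \<le> _)")
proof -
  have proj: "diag_proj z = z - (1 / ?N) *\<^sub>R 1" if "(\<Sum>i\<in>UNIV. z $ i) = 1" for z :: "real ^ 'n option"
    using that by (simp add: diag_proj_def inner_one_vec)
  show ?thesis
  proof
    assume "y \<in> std_simplex \<iota>"
    then obtain z where "\<And>i. 0 \<le> z $ i" "(\<Sum>i\<in>UNIV. z $ i) = 1" "\<iota> y = diag_proj z"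
      by (auto simp: std_simplex_def convex_hull_axes)
    then show "\<forall>i. - 1 / ?N \<le> \<iota> y $ i"
      using proj by simp
  next
    assume le: "\<forall>i. - 1 / ?N \<le> \<iota> y $ i"
    define z where "z = \<iota> y + (1 / ?N) *\<^sub>R 1"
    have s: "(\<Sum>i\<in>UNIV. z $ i) = 1"
      unfolding z_def by (simp add: sum.distrib iso_sum_zero[OF assms] del: card_UNIV_option)
    moreover have "0 \<le> z $ i" for i
      using le[rule_format, of i] by (simp add: z_def)
    ultimately have "z \<in> convex hull (range (\<lambda>i. axis i 1))"
      by (simp add: convex_hull_axes)
    moreover have "\<iota> y = diag_proj z"
      using proj[OF s] by (simp add: z_def)
    ultimately show "y \<in> std_simplex \<iota>"
      by (auto simp: std_simplex_def)
  qed
qed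

lemma mem_scaled_std_simplex:
  fixes \<iota> :: "real ^ 'n \<Rightarrow> real ^ 'n option"
  assumes iso: "isometric_identification \<iota>" and "0 \<le> l"
  shows "z \<in> (\<lambda>y. x + l *\<^sub>R y) ` std_simplex \<iota> \<longleftrightarrow>
    (\<forall>i. \<iota> x $ i - l / real CARD('n option) \<le> \<iota> z $ i)"
    (is "_ \<longleftrightarrow> (\<forall>i. _ - l / ?N \<le> _)")
proof
  assume "z \<in> (\<lambda>y. x + l *\<^sub>R y) ` std_simplex \<iota>"
  then obtain y where z: "z = x + l *\<^sub>R y" and y: "y \<in> std_simplex \<iota>" by auto
  show "\<forall>i. \<iota> x $ i - l / ?N \<le> \<iota> z $ i"
  proof
    fix i
    have "- 1 / ?N \<le> \<iota> y $ i"
      using y mem_std_simplex[OF iso] by blast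
    from mult_left_mono[OF this \<open>0 \<le> l\<close>]
    show "\<iota> x $ i - l / ?N \<le> \<iota> z $ i"
      by (simp add: z linear_add[OF iso_linear[OF iso]] linear_scale[OF iso_linear[OF iso]])
  qed
next
  assume le: "\<forall>i. \<iota> x $ i - l / ?N \<le> \<iota> z $ i"
  show "z \<in> (\<lambda>y. x + l *\<^sub>R y) ` std_simplex \<iota>"
  proof (cases "l = 0")
    case True
    \<comment> \<open>A zero-sum vector dominated by another zero-sum vector is equal to it.\<close>
    have "(\<Sum>i\<in>UNIV. \<iota> z $ i - \<iota> x $ i) = 0"
      by (simp add: sum_subtractf iso_sum_zero[OF iso])
    moreover have "0 \<le> \<iota> z $ i - \<iota> x $ i" for i
      using le True by simp
    ultimately have "\<forall>i. \<iota> z $ i - \<iota> x $ i = 0"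
      using sum_nonneg_eq_0_iff[of UNIV "\<lambda>i. \<iota> z $ i - \<iota> x $ i"] by simp
    then have "z = x"
      by (intro iso_inj[OF iso]) (simp add: vec_eq_iff)
    moreover have "0 \<in> std_simplex \<iota>"
      by (simp add: mem_std_simplex[OF iso] linear_0[OF iso_linear[OF iso]])
    ultimately show ?thesis
      using True by auto
  next
    case False
    with \<open>0 \<le> l\<close> have l: "0 < l" by simp
    define y where "y = (1 / l) *\<^sub>R (z - x)"
    have "- 1 / ?N \<le> \<iota> y $ i" for i
    proof -
      have "- 1 / ?N = (- l / ?N) / l"
        using l by simp
      also have "\<dots> \<le> (\<iota> z $ i - \<iota> x $ i) / l"
        using le[rule_format, of i] l by (intro divide_right_mono) auto
      also have "\<dots> = \<iota> y $ i"
        by (simp add: y_def linear_diff[OF iso_linear[OF iso]] linear_scale[OF iso_linear[OF iso]])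
      finally show ?thesis .
    qed
    then have "y \<in> std_simplex \<iota>"
      by (simp add: mem_std_simplex[OF iso])
    moreover have "z = x + l *\<^sub>R y"
      using l by (simp add: y_def)
    ultimately show ?thesis by blast
  qed
qed

section \<open>Circumscribed scales in terms of extreme coordinates\<close>

lemma sum_coord_INF_le_0:
  assumes "isometric_identification \<iota>" and "bounded L" and "L \<noteq> {}"
  shows "(\<Sum>i\<in>UNIV. INF x\<in>L. \<iota> x $ i) \<le> 0"
proof -
  obtain x where "x \<in> L" using assms(3) by blast
  then have "(\<Sum>i\<in>UNIV. INF x\<in>L. \<iota> x $ i) \<le> (\<Sum>i\<in>UNIV. \<iota> x $ i)"
    by (intro sum_mono cINF_lower bdd_coord assms)
  then show ?thesis
    by (simp add: iso_sum_zero[OF assms(1)])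
qed

text \<open>
  If the coordinate infima had sum zero, every point of \<open>L\<close> would dominate them with the same
  sum, hence have exactly these coordinates.
\<close>

lemma sum_coord_INF_neg:
  assumes iso: "isometric_identification \<iota>" and bdd: "bounded L" and ne: "L \<noteq> {}"
    and not_point: "\<nexists>a. L = {a}"
  shows "(\<Sum>i\<in>UNIV. INF x\<in>L. \<iota> x $ i) < 0"
proof (rule ccontr)
  let ?m = "\<lambda>i. INF x\<in>L. \<iota> x $ i"
  assume "\<not> (\<Sum>i\<in>UNIV. ?m i) < 0"
  with sum_coord_INF_le_0[OF iso bdd ne] have zero: "(\<Sum>i\<in>UNIV. ?m i) = 0" by simp
  have coords: "\<iota> x $ i = ?m i" if "x \<in> L" for x i
  proof -
    have "0 \<le> \<iota> x $ i - ?m i" for i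
      using cINF_lower[OF bdd_coord(1)[OF iso bdd] that] by simp
    moreover have "(\<Sum>i\<in>UNIV. \<iota> x $ i - ?m i) = 0"
      by (simp add: sum_subtractf iso_sum_zero[OF iso] zero)
    ultimately have "\<iota> x $ i - ?m i = 0"
      using sum_nonneg_eq_0_iff[of UNIV "\<lambda>i. \<iota> x $ i - ?m i"] by simp
    then show ?thesis by simp
  qed
  obtain a where a: "a \<in> L" using ne by blast
  have "x = a" if "x \<in> L" for x
    by (rule iso_inj[OF iso]) (simp add: vec_eq_iff coords[OF that] coords[OF a])
  with a not_point show False by blast
qed

text \<open>
  Summing the lower bounds that define $x + l\Delta$ gives $-l$, so \<open>l\<close> is admissible only if
  $\sum_i m_i \ge -l$. Conversely the coordinate infima become the centre of a translate after
  being shifted to sum zero by a common constant.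
\<close>

lemma circumscale_std_simplex:
  fixes \<iota> :: "real ^ 'n \<Rightarrow> real ^ 'n option"
  assumes iso: "isometric_identification \<iota>" and bdd: "bounded L" and ne: "L \<noteq> {}"
  shows "circumscale (std_simplex \<iota>) L = - (\<Sum>i\<in>UNIV. INF x\<in>L. \<iota> x $ i)"
proof -
  define N where "N = real CARD('n option)"
  have N0: "0 < N" by (simp add: N_def)
  note mem_scaled = mem_scaled_std_simplex[OF iso, folded N_def]
  let ?m = "\<lambda>i. INF x\<in>L. \<iota> x $ i"
  define h where "h = - (\<Sum>i\<in>UNIV. ?m i)"
  have h0: "0 \<le> h"
    using sum_coord_INF_le_0[OF iso bdd ne] by (simp add: h_def)
  have sum_const: "(\<Sum>i\<in>(UNIV :: 'n option set). c / N) = c" for c :: real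
    using N0 by (simp only: sum_constant N_def) simp
  have "{l. 0 \<le> l \<and> (\<exists>x. L \<subseteq> (\<lambda>y. x + l *\<^sub>R y) ` std_simplex \<iota>)} = {h..}"
  proof (intro equalityI subsetI)
    fix l assume "l \<in> {l. 0 \<le> l \<and> (\<exists>x. L \<subseteq> (\<lambda>y. x + l *\<^sub>R y) ` std_simplex \<iota>)}"
    then obtain x where "0 \<le> l" and sub: "L \<subseteq> (\<lambda>y. x + l *\<^sub>R y) ` std_simplex \<iota>" by auto
    have "\<iota> x $ i - l / N \<le> ?m i" for i
      using sub mem_scaled[OF \<open>0 \<le> l\<close>] by (intro cINF_greatest ne) blast
    then have "(\<Sum>i\<in>UNIV. \<iota> x $ i - l / N) \<le> (\<Sum>i\<in>UNIV. ?m i)"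
      by (intro sum_mono) auto
    then show "l \<in> {h..}"
      by (simp add: h_def sum_subtractf iso_sum_zero[OF iso] sum_const del: sum_constant)
  next
    fix l assume "l \<in> {h..}"
    then have "h \<le> l" by simp
    \<comment> \<open>The centre is the one for the smallest scale \<open>h\<close>; it serves every larger scale too.\<close>
    have "(\<Sum>i\<in>UNIV. (\<chi> i. ?m i + h / N) $ i) = - h + h"
      by (simp only: vec_lambda_beta sum.distrib sum_const) (simp add: h_def)
    then obtain x where x: "\<iota> x = (\<chi> i. ?m i + h / N)"
      using iso_onto_zero_sum[OF iso] by (metis add.left_inverse)
    have "\<iota> x $ i - l / N \<le> \<iota> z $ i" if "z \<in> L" for z i
    proof -
      have "h / N \<le> l / N"
        using \<open>h \<le> l\<close> N0 by (intro divide_right_mono) auto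
      then have "\<iota> x $ i - l / N \<le> ?m i" by (simp add: x)
      also have "\<dots> \<le> \<iota> z $ i"
        by (rule cINF_lower[OF bdd_coord(1)[OF iso bdd] that])
      finally show ?thesis .
    qed
    then have "L \<subseteq> (\<lambda>y. x + l *\<^sub>R y) ` std_simplex \<iota>"
      using mem_scaled h0 \<open>h \<le> l\<close> by (meson order_trans subsetI)
    then show "l \<in> {l. 0 \<le> l \<and> (\<exists>x. L \<subseteq> (\<lambda>y. x + l *\<^sub>R y) ` std_simplex \<iota>)}"
      using h0 \<open>h \<le> l\<close> by auto
  qed
  then show ?thesis
    by (simp add: circumscale_def h_def)
qed

lemma circumscale_uminus: "circumscale (uminus ` K) L = circumscale K (uminus ` L)"
proof -
  have "(\<exists>x. L \<subseteq> (\<lambda>y. x + l *\<^sub>R y) ` uminus ` K) \<longleftrightarrow> (\<exists>x. uminus ` L \<subseteq> (\<lambda>y. x + l *\<^sub>R y) ` K)" for l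
  proof -
    have ex_uminus: "(\<exists>x. P (- x)) \<longleftrightarrow> (\<exists>x. P x)" for P :: "real ^ 'a \<Rightarrow> bool"
    proof
      assume "\<exists>x. P x"
      then obtain x where "P (- (- x))" by auto
      then show "\<exists>x. P (- x)" ..
    qed blast
    have eq: "uminus ` (\<lambda>y. x + l *\<^sub>R y) ` uminus ` K = (\<lambda>y. - x + l *\<^sub>R y) ` K" for x
      by (simp add: image_image)
    have "L \<subseteq> (\<lambda>y. x + l *\<^sub>R y) ` uminus ` K \<longleftrightarrow>
        uminus ` L \<subseteq> uminus ` (\<lambda>y. x + l *\<^sub>R y) ` uminus ` K" for x
      by (rule inj_image_subset_iff[symmetric]) simp
    then have "L \<subseteq> (\<lambda>y. x + l *\<^sub>R y) ` uminus ` K \<longleftrightarrow> uminus ` L \<subseteq> (\<lambda>y. - x + l *\<^sub>R y) ` K" for x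
      by (simp only: eq)
    then show ?thesis
      using ex_uminus[of "\<lambda>x. uminus ` L \<subseteq> (\<lambda>y. x + l *\<^sub>R y) ` K"] by simp
  qed
  then show ?thesis
    by (simp add: circumscale_def)
qed

lemma circumscale_neg_std_simplex:
  fixes \<iota> :: "real ^ 'n \<Rightarrow> real ^ 'n option"
  assumes iso: "isometric_identification \<iota>" and bdd: "bounded L" and ne: "L \<noteq> {}"
  shows "circumscale (uminus ` std_simplex \<iota>) L = (\<Sum>i\<in>UNIV. SUP x\<in>L. \<iota> x $ i)"
proof -
  have "(INF x\<in>uminus ` L. \<iota> x $ i) = - (SUP x\<in>L. \<iota> x $ i)" for i
    by (simp add: image_image linear_neg[OF iso_linear[OF iso]] Inf_real_def)
  then show ?thesis
    using circumscale_std_simplex[OF iso, of "uminus ` L"] bdd ne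
    by (simp add: circumscale_uminus sum_negf)
qed

section \<open>Convex hull of a union\<close>

text \<open>
  Both sets lie in the half-space where the coordinate is at most the larger supremum, and this
  half-space is convex.
\<close>

lemma coord_SUP_hull_Un_le:
  assumes iso: "isometric_identification \<iota>"
    and "bounded L1" "L1 \<noteq> {}" "bounded L2" "L2 \<noteq> {}"
  shows "(SUP x\<in>convex hull (L1 \<union> L2). \<iota> x $ i) \<le> max (SUP x\<in>L1. \<iota> x $ i) (SUP x\<in>L2. \<iota> x $ i)"
    (is "_ \<le> ?c")
proof (rule cSUP_least)
  show "convex hull (L1 \<union> L2) \<noteq> {}"
    using assms by simp
  have "linear (\<lambda>x. \<iota> x $ i)"
    using linear_compose[OF iso_linear[OF iso] bounded_linear.linear[OF bounded_linear_vec_nth]]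
    by (simp add: o_def)
  then have "convex ((\<lambda>x. \<iota> x $ i) -` {..?c})"
    by (intro convex_linear_vimage) auto
  moreover have "L1 \<union> L2 \<subseteq> (\<lambda>x. \<iota> x $ i) -` {..?c}"
    using cSUP_upper[OF _ bdd_coord(2)[OF iso \<open>bounded L1\<close>]]
      cSUP_upper[OF _ bdd_coord(2)[OF iso \<open>bounded L2\<close>]]
    by (auto simp: le_max_iff_disj)
  ultimately show "\<iota> x $ i \<le> ?c" if "x \<in> convex hull (L1 \<union> L2)" for x
    using hull_minimal[of "L1 \<union> L2" "(\<lambda>x. \<iota> x $ i) -` {..?c}" convex] that by blast
qed

theorem theorem10:
  fixes \<iota> :: "real ^ 'n \<Rightarrow> real ^ 'n option"
    and L L1 L2 :: "(real ^ 'n) set"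
  assumes "isometric_identification \<iota>"
    and "compact L1" and "convex L1" and "L1 \<noteq> {}" and "\<nexists>a. L1 = {a}"
    and "compact L2" and "convex L2" and "L2 \<noteq> {}" and "\<nexists>a. L2 = {a}"
    and "L = convex hull (L1 \<union> L2)"
  shows "rho (std_simplex \<iota>) L \<le> rho (std_simplex \<iota>) L1 + rho (std_simplex \<iota>) L2 + 1"
proof -
  note iso = assms(1)
  have bdd1: "bounded L1" and bdd2: "bounded L2"
    using assms by (auto intro: compact_imp_bounded)
  have bdd: "bounded L" and ne: "L \<noteq> {}" and sub1: "L1 \<subseteq> L" and sub2: "L2 \<subseteq> L"
    using assms bdd1 bdd2 hull_subset[of "L1 \<union> L2" convex] by (auto simp: bounded_convex_hull)
  define m where "m K i = (INF x\<in>K. \<iota> x $ i)" for K i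
  define M where "M K i = (SUP x\<in>K. \<iota> x $ i)" for K i
  define lo where "lo K = - (\<Sum>i\<in>UNIV. m K i)" for K
  define hi where "hi K = (\<Sum>i\<in>UNIV. M K i)" for K
  have rho_eq: "rho (std_simplex \<iota>) K = hi K / lo K" if "bounded K" "K \<noteq> {}" for K
    using that by (simp add: rho_def circumscale_std_simplex[OF iso]
        circumscale_neg_std_simplex[OF iso] lo_def hi_def m_def M_def)
  have m_le_M: "m K i \<le> M K i" if "bounded K" "K \<noteq> {}" for K i
  proof -
    obtain x where "x \<in> K" using \<open>K \<noteq> {}\<close> by blast
    then show ?thesis
      unfolding m_def M_def
      using cINF_lower[OF bdd_coord(1)[OF iso \<open>bounded K\<close>]]
        cSUP_upper[OF _ bdd_coord(2)[OF iso \<open>bounded K\<close>]] order_trans by fast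
  qed
  have m_anti: "m L i \<le> m K i" if "K \<subseteq> L" "K \<noteq> {}" for K i
    unfolding m_def using that by (intro cINF_superset_mono bdd_coord[OF iso] bdd) auto
  have lo_mono: "lo K \<le> lo L" if "K \<subseteq> L" "K \<noteq> {}" for K
    using m_anti[OF that] by (simp add: lo_def sum_mono)
  have lo_pos: "0 < lo L1" "0 < lo L2"
    using sum_coord_INF_neg[OF iso bdd1] sum_coord_INF_neg[OF iso bdd2] assms
    by (auto simp: lo_def m_def)
  have hi_nonneg: "0 \<le> hi K" if bK: "bounded K" and neK: "K \<noteq> {}" for K
  proof -
    obtain x where x: "x \<in> K" using neK by blast
    have "(\<Sum>i\<in>UNIV. \<iota> x $ i) \<le> hi K"
      unfolding hi_def M_def by (intro sum_mono cSUP_upper x bdd_coord[OF iso bK])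
    then show ?thesis by (simp add: iso_sum_zero[OF iso])
  qed
  \<comment> \<open>The maximum of the two suprema is their sum less their minimum, and \<open>m L i\<close> bounds that
    minimum from below.\<close>
  have "M L i \<le> M L1 i + M L2 i - m L i" for i
  proof -
    have "M L i \<le> max (M L1 i) (M L2 i)"
      unfolding M_def assms(10) using assms bdd1 bdd2 by (intro coord_SUP_hull_Un_le)
    moreover have "m L i \<le> M L1 i" "m L i \<le> M L2 i"
      using m_anti[OF sub1] m_anti[OF sub2] m_le_M[OF bdd1] m_le_M[OF bdd2] assms
      by (meson order_trans)+
    ultimately show ?thesis by linarith
  qed
  then have "hi L \<le> (\<Sum>i\<in>UNIV. M L1 i + M L2 i - m L i)"
    unfolding hi_def by (intro sum_mono) auto
  also have "\<dots> = hi L1 + hi L2 + lo L"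
    by (simp add: hi_def lo_def sum.distrib sum_subtractf)
  finally have main: "hi L \<le> hi L1 + hi L2 + lo L" .
  have pos: "0 < lo L"
    using lo_pos(1) lo_mono[OF sub1] assms by auto
  have "hi L / lo L \<le> (hi L1 + hi L2 + lo L) / lo L"
    using main pos by (intro divide_right_mono) auto
  also have "\<dots> = hi L1 / lo L + hi L2 / lo L + 1"
    using pos by (simp add: add_divide_distrib)
  also have "\<dots> \<le> hi L1 / lo L1 + hi L2 / lo L2 + 1"
    using lo_pos lo_mono[OF sub1] lo_mono[OF sub2] hi_nonneg[OF bdd1] hi_nonneg[OF bdd2] assms
    by (intro add_mono divide_left_mono mult_pos_pos) auto
  finally show ?thesis
    using rho_eq[OF bdd ne] rho_eq[OF bdd1] rho_eq[OF bdd2] assms by simp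
qed

end
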